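(* Let $G$ be a topological group, let $T_1,T_2,T_3\subseteq G$ be locally cofinite at $0$, and let $E_3 = T_1+T_2+T_3 = \{a_1+a_2+a_3 : a_i\in T_i\}$. Let $g\in E_3$. Then either $g$ has only finitely many representations in $E_3$, or $g\in T_1\cup T_2\cup T_3$, or $g=0$.
   Context: A topological group $\langle G,0,+,-\rangle$ is a group, written additively but not assumed abelian, equipped with a Hausdorff topology for which addition and additive inverse are continuous. A subset $T\subseteq G$ is called locally cofinite at $0$ if (1) $0\notin T$, and (2) for every open neighborhood $u$ of $0$, the set $T\setminus u$ is finite. A representation of $g$ in $E_3$ is a tuple $\langle g_1,g_2,g_3\rangle\in T_1\times T_2\times T_3$ such that $g=g_1+g_2+g_3$. *)

theory Defs
  imports Complex_Main
begin

(* Topological groups are rendered by the sort {topological_group_add, t2_space}: the class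
   group_add is not assumed commutative, and t2_space supplies the Hausdorff axiom. *)

definition locally_cofinite_at_zero :: "'a::{topological_group_add, t2_space} set \<Rightarrow> bool" where
  "locally_cofinite_at_zero T \<longleftrightarrow> 0 \<notin> T \<and> (\<forall>U. open U \<and> 0 \<in> U \<longrightarrow> finite (T - U))"

definition E3 :: "'a::group_add set \<Rightarrow> 'a set \<Rightarrow> 'a set \<Rightarrow> 'a set" where
  "E3 T1 T2 T3 = {a1 + a2 + a3 | a1 a2 a3. a1 \<in> T1 \<and> a2 \<in> T2 \<and> a3 \<in> T3}"

definition representations3 ::
    "'a::group_add set \<Rightarrow> 'a set \<Rightarrow> 'a set \<Rightarrow> 'a \<Rightarrow> ('a \<times> 'a \<times> 'a) set" where
  "representations3 T1 T2 T3 g = {(g1, g2, g3) \<in> T1 \<times> T2 \<times> T3. g = g1 + g2 + g3}"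

end

theory Submission
  imports Defs
begin

text \<open>If \<open>g \<noteq> 0\<close>, continuity of addition gives a neighbourhood \<open>u\<close> of \<open>0\<close> with \<open>g \<notin> u + u + u\<close>,
  so every representation of \<open>g\<close> has a component outside \<open>u\<close>, hence in one of the finite sets
  \<open>T\<^sub>i - u\<close>. If that component has a fixed value \<open>t \<noteq> g\<close>, the same argument applied to the other two
  components finds a second component in a finite set, and the two determine the third.\<close>

text \<open>Filter form of local cofiniteness, so that neighbourhoods coming from limits can be used
  without naming an open set.\<close>

lemma locally_cofinite_at_zero_finite:
  assumes "locally_cofinite_at_zero T" "eventually P (nhds 0)"
  shows "finite {t \<in> T. \<not> P t}"
proof -
  obtain U where U: "open U" "0 \<in> U" "\<And>x. x \<in> U \<Longrightarrow> P x"
    using assms(2) by (auto simp: eventually_nhds)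
  have "finite (T - U)"
    using assms(1) U by (auto simp: locally_cofinite_at_zero_def)
  then show ?thesis
    by (rule rev_finite_subset) (use U in auto)
qed

text \<open>The sum is continuous at \<open>(0, 0)\<close> with value \<open>b\<close>, and the
  Hausdorff property separates \<open>b\<close> from \<open>h\<close>. Keeping \<open>b\<close> in
  the middle is what the noncommutative case demands; \<open>b = 0\<close> covers a fixed summand at
  either end.\<close>

lemma eventually_sum_around_ne:
  fixes b h :: "'a::{topological_group_add, t2_space}"
  assumes "h \<noteq> b"
  shows "\<exists>P. eventually P (nhds 0) \<and> (\<forall>x y. P x \<longrightarrow> P y \<longrightarrow> x + b + y \<noteq> h)"
proof -
  have "((\<lambda>p. fst p + b + snd p) \<longlongrightarrow> 0 + b + 0) (nhds (0::'a) \<times>\<^sub>F nhds 0)"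
    unfolding nhds_prod[symmetric]
    by (intro tendsto_add tendsto_const tendsto_fst[where a = "(0, 0)", simplified]
        tendsto_snd[where a = "(0, 0)", simplified] filterlim_ident)
  then have "\<forall>\<^sub>F p in nhds (0::'a) \<times>\<^sub>F nhds 0. fst p + b + snd p \<noteq> h"
    using assms by (intro tendsto_imp_eventually_ne) auto
  then show ?thesis
    by (auto simp: eventually_prod_same)
qed

lemma finite_pairs_sum_around:
  assumes "locally_cofinite_at_zero S" "locally_cofinite_at_zero T" "h \<noteq> b"
  shows "finite {(x, y). x \<in> S \<and> y \<in> T \<and> x + b + y = h}"
proof -
  obtain P where ev: "eventually P (nhds 0)"
    and P: "\<And>x y. P x \<Longrightarrow> P y \<Longrightarrow> x + b + y \<noteq> h"
    using eventually_sum_around_ne[OF assms(3)] by blast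
  \<comment> \<open>One of \<open>x\<close>, \<open>y\<close> must violate \<open>P\<close>, which
    leaves finitely many values for it; solving \<open>x + b + y = h\<close> gives the
    other.\<close>
  have "{(x, y). x \<in> S \<and> y \<in> T \<and> x + b + y = h}
      \<subseteq> (\<lambda>x. (x, - (x + b) + h)) ` {x \<in> S. \<not> P x} \<union> (\<lambda>y. (h - y - b, y)) ` {y \<in> T. \<not> P y}"
  proof
    fix p
    assume "p \<in> {(x, y). x \<in> S \<and> y \<in> T \<and> x + b + y = h}"
    then obtain x y where p: "p = (x, y)" and xy: "x \<in> S" "y \<in> T" "x + b + y = h"
      by blast
    have "y = - (x + b) + h" "x = h - y - b"
      by (simp_all only: xy(3)[symmetric] minus_add_cancel add_diff_cancel)
    moreover have "\<not> P x \<or> \<not> P y"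
      using P xy by blast
    ultimately show "p \<in> (\<lambda>x. (x, - (x + b) + h)) ` {x \<in> S. \<not> P x}
        \<union> (\<lambda>y. (h - y - b, y)) ` {y \<in> T. \<not> P y}"
      using xy p by blast
  qed
  then show ?thesis
    by (rule finite_subset)
      (intro finite_UnI finite_imageI locally_cofinite_at_zero_finite[OF _ ev] assms)
qed

lemma eventually_sum3_ne:
  fixes h :: "'a::{topological_group_add, t2_space}"
  assumes "h \<noteq> 0"
  shows "\<exists>P. eventually P (nhds 0) \<and> (\<forall>x y z. P x \<longrightarrow> P y \<longrightarrow> P z \<longrightarrow> x + y + z \<noteq> h)"
proof -
  have "((\<lambda>p. fst p + fst (snd p) + snd (snd p)) \<longlongrightarrow> 0 + 0 + 0)
      (nhds (0::'a) \<times>\<^sub>F nhds 0 \<times>\<^sub>F nhds 0)"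
    unfolding nhds_prod[symmetric]
    by (intro tendsto_add tendsto_fst[where a = "(0, 0, 0)", simplified]
        tendsto_fst[where a = "(0, 0)", simplified] tendsto_snd[where a = "(0, 0)", simplified]
        tendsto_snd[where a = "(0, 0, 0)", simplified] filterlim_ident)
  then have "\<forall>\<^sub>F p in nhds (0::'a) \<times>\<^sub>F nhds 0 \<times>\<^sub>F nhds 0. fst p + fst (snd p) + snd (snd p) \<noteq> h"
    using assms by (intro tendsto_imp_eventually_ne) auto
  then obtain P Q where P: "eventually P (nhds 0)" and Q: "eventually Q (nhds 0 \<times>\<^sub>F nhds 0)"
    and PQ: "\<And>x y z. P x \<Longrightarrow> Q (y, z) \<Longrightarrow> x + y + z \<noteq> h"
    by (auto simp: eventually_prod_filter[of _ "nhds 0" "nhds 0 \<times>\<^sub>F nhds 0"])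
  from Q obtain R where R: "eventually R (nhds 0)" "\<And>y z. R y \<Longrightarrow> R z \<Longrightarrow> Q (y, z)"
    by (auto simp: eventually_prod_same)
  show ?thesis
    \<comment> \<open>\<open>P\<close> controls the first summand and \<open>R\<close> the other
      two; their conjunction serves all three at once.\<close>
    by (intro exI[of _ "\<lambda>x. P x \<and> R x"]) (use P R PQ in \<open>auto intro: eventually_conj\<close>)
qed

theorem theorem2p3:
  fixes T1 T2 T3 :: "'a::{topological_group_add, t2_space} set" and g :: 'a
  assumes "locally_cofinite_at_zero T1"
    and "locally_cofinite_at_zero T2"
    and "locally_cofinite_at_zero T3"
    and "g \<in> E3 T1 T2 T3"
  shows "finite (representations3 T1 T2 T3 g) \<or> g \<in> T1 \<union> T2 \<union> T3 \<or> g = 0"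
proof -
  have "finite (representations3 T1 T2 T3 g)" if g: "g \<notin> T1 \<union> T2 \<union> T3" "g \<noteq> 0"
  proof -
    obtain P where ev: "eventually P (nhds 0)"
      and P: "\<And>x y z. P x \<Longrightarrow> P y \<Longrightarrow> P z \<Longrightarrow> x + y + z \<noteq> g"
      using eventually_sum3_ne[OF g(2)] by blast
    define F where "F S T b h = {(x, y). x \<in> S \<and> y \<in> T \<and> x + b + y = h}" for S T and b h :: 'a
    \<comment> \<open>Representations are sorted by a component \<open>t\<close> violating
      \<open>P\<close>. An outer \<open>t\<close> is moved to the other side, leaving
      \<open>b = 0\<close>; a middle \<open>t\<close> cannot be moved and becomes
      \<open>b\<close>.\<close>
    define A where "A = (\<Union>t\<in>{t \<in> T1. \<not> P t}. (\<lambda>(x, y). (t, x, y)) ` F T2 T3 0 (- t + g))"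
    define B where "B = (\<Union>t\<in>{t \<in> T2. \<not> P t}. (\<lambda>(x, y). (x, t, y)) ` F T1 T3 t g)"
    define C where "C = (\<Union>t\<in>{t \<in> T3. \<not> P t}. (\<lambda>(x, y). (x, y, t)) ` F T1 T2 0 (g - t))"
    \<comment> \<open>Finiteness of each fibre \<open>F\<close> needs \<open>h \<noteq> b\<close>.
      In all three cases this amounts to \<open>t \<noteq> g\<close>, which is where
      \<open>g \<notin> T1 \<union> T2 \<union> T3\<close> enters.\<close>
    have "- t + g \<noteq> 0" if "t \<in> T1" for t
      using that g by (metis UnCI add.right_neutral add_minus_cancel)
    then have "finite A"
      unfolding A_def F_def
      by (intro finite_UN_I finite_imageI locally_cofinite_at_zero_finite[OF _ ev]
          finite_pairs_sum_around assms) auto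
    moreover have "finite B"
      unfolding B_def F_def
      by (intro finite_UN_I finite_imageI locally_cofinite_at_zero_finite[OF _ ev]
          finite_pairs_sum_around assms) (use g in auto)
    moreover have "finite C"
      unfolding C_def F_def
      by (intro finite_UN_I finite_imageI locally_cofinite_at_zero_finite[OF _ ev]
          finite_pairs_sum_around assms) (use g in auto)
    moreover have "representations3 T1 T2 T3 g \<subseteq> A \<union> B \<union> C"
    proof
      fix r
      assume "r \<in> representations3 T1 T2 T3 g"
      then obtain x y z where r: "r = (x, y, z)"
        and T: "x \<in> T1" "y \<in> T2" "z \<in> T3" and s: "g = x + y + z"
        by (auto simp: representations3_def)
      have "y + 0 + z = - x + g"
        by (simp add: s add.assoc)
      moreover have "x + 0 + y = g - z"
        by (simp add: s)
      ultimately have "(y, z) \<in> F T2 T3 0 (- x + g)" "(x, z) \<in> F T1 T3 y g" "(x, y) \<in> F T1 T2 0 (g - z)"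
        using T s by (simp_all add: F_def)
      moreover have "\<not> P x \<or> \<not> P y \<or> \<not> P z"
        using P s by blast
      ultimately show "r \<in> A \<union> B \<union> C"
        unfolding A_def B_def C_def r using T by force
    qed
    ultimately show ?thesis
      by (meson finite_UnI finite_subset)
  qed
  then show ?thesis by blast
qed

end
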